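(* Let $n\geqslant 3$ be an integer and let $q$ be a prime. Let $\vec{a}=(a_1,\ldots,a_n)\in\mathbb{Z}^n$ and $\vec{k}=(k_1,\ldots,k_n)\in\mathbb{Z}^n$ satisfy $$a_i\not\equiv 0 \pmod q,\qquad k_i>0,\qquad k_i\neq k_j \quad (1\leqslant i,j\leqslant n,\ i\neq j),$$ and let $\vec{h}=(h_1,\ldots,h_n)\in\mathbb{N}^n$ satisfy $1\leqslant h_1\leqslant h_2\leqslant\cdots\leqslant h_n$. Then $$\#\mathcal{U}_{n,q}(\vec{a},\vec{k},\vec{h})\ll (h_1h_2h_3)^{1/2}\log q,$$ where the implied constant depends only on $n$ and $\vec{k}$.
   Context: $\mathbb{F}_q$ is identified with $\{0,1,\ldots,q-1\}$. For a real $\zeta$, $\|\zeta\|$ denotes the distance from $\zeta$ to the nearest integer. For $\vec a,\vec k,\vec h$ as in the claim, $\mathcal{U}_{n,q}(\vec{a},\vec{k},\vec{h})$ denotes the set of $u\in\mathbb{F}_q$ for which the Bohr set $$\{s\in\mathbb{F}_q:\ \|a_j u^{k_j} s/q\|\leqslant h_j/q,\ j=1,\ldots,n\}$$ is nontrivial (i.e. contains some $s\neq 0$); equivalently, the set of $u\in\mathbb{F}_q$ for which there exist $s\in\{1,\ldots,q-1\}$ and integers $x_1,\ldots,x_n$ with $|x_j|\leqslant h_j$ and $s a_j u^{k_j}\equiv x_j \pmod q$ for $j=1,\ldots,n$. The notation $A\ll B$ means $|A|\leqslant cB$ for a constant $c>0$. *)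

theory Defs
  imports Complex_Main "HOL-Number_Theory.Cong" "HOL-Computational_Algebra.Primes"
begin

definition dist_int :: "real \<Rightarrow> real" where
  "dist_int \<zeta> = \<bar>\<zeta> - of_int (round \<zeta>)\<bar>"

text \<open>Vectors of length \<open>n\<close> are functions on \<open>nat\<close>, of which only the values at the
  indices \<open>1, \<dots>, n\<close> are used; the field with \<open>q\<close> elements is \<open>{..<q}\<close>.\<close>

definition bohr_set ::
  "nat \<Rightarrow> nat \<Rightarrow> (nat \<Rightarrow> int) \<Rightarrow> (nat \<Rightarrow> nat) \<Rightarrow> (nat \<Rightarrow> nat) \<Rightarrow> nat \<Rightarrow> nat set" where
  "bohr_set n q a k h u =
     {s \<in> {..<q}. \<forall>j\<in>{1..n}.
        dist_int (real_of_int (a j * int u ^ k j * int s) / real q) \<le> real (h j) / real q}"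

definition nontrivial_bohr ::
  "nat \<Rightarrow> nat \<Rightarrow> (nat \<Rightarrow> int) \<Rightarrow> (nat \<Rightarrow> nat) \<Rightarrow> (nat \<Rightarrow> nat) \<Rightarrow> nat set" where
  "nontrivial_bohr n q a k h = {u \<in> {..<q}. \<exists>s\<in>bohr_set n q a k h u. s \<noteq> 0}"

lemma dist_int_le_iff:
  "dist_int \<zeta> \<le> r \<longleftrightarrow> (\<exists>m::int. \<bar>\<zeta> - of_int m\<bar> \<le> r)"
proof
  assume "\<exists>m::int. \<bar>\<zeta> - of_int m\<bar> \<le> r"
  then obtain m :: int where "\<bar>\<zeta> - of_int m\<bar> \<le> r" ..
  then show "dist_int \<zeta> \<le> r"
    unfolding dist_int_def using round_diff_minimal[of \<zeta> m] by linarith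
qed (auto simp: dist_int_def)

lemma dist_int_divide_le_iff:
  fixes y :: int and h q :: nat
  assumes "q > 0"
  shows "dist_int (real_of_int y / real q) \<le> real h / real q \<longleftrightarrow>
         (\<exists>x::int. \<bar>x\<bar> \<le> int h \<and> [y = x] (mod int q))"
proof -
  have eq: "\<bar>real_of_int y / real q - of_int m\<bar> \<le> real h / real q \<longleftrightarrow> \<bar>y - m * int q\<bar> \<le> int h"
    for m :: int
  proof -
    have "real_of_int y / real q - of_int m = real_of_int (y - m * int q) / real q"
      using assms by (simp add: field_simps)
    then have "\<bar>real_of_int y / real q - of_int m\<bar> = real_of_int \<bar>y - m * int q\<bar> / real q"
      by simp
    also have "\<dots> \<le> real h / real q \<longleftrightarrow> real_of_int \<bar>y - m * int q\<bar> \<le> real_of_int (int h)"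
      using assms by (simp add: divide_le_cancel)
    finally show ?thesis
      by (simp only: of_int_le_iff)
  qed
  have "(\<exists>m. \<bar>y - m * int q\<bar> \<le> int h) \<longleftrightarrow> (\<exists>x. \<bar>x\<bar> \<le> int h \<and> [y = x] (mod int q))"
  proof
    assume "\<exists>m. \<bar>y - m * int q\<bar> \<le> int h"
    then obtain m where "\<bar>y - m * int q\<bar> \<le> int h" ..
    moreover have "[y = y - m * int q] (mod int q)"
      by (simp add: cong_iff_dvd_diff)
    ultimately show "\<exists>x. \<bar>x\<bar> \<le> int h \<and> [y = x] (mod int q)" by blast
  next
    assume "\<exists>x. \<bar>x\<bar> \<le> int h \<and> [y = x] (mod int q)"
    then obtain x m where "\<bar>x\<bar> \<le> int h" "y - x = int q * m"
      by (auto simp: cong_iff_dvd_diff elim!: dvdE)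
    then have "\<bar>y - m * int q\<bar> \<le> int h" by (simp add: algebra_simps)
    then show "\<exists>m. \<bar>y - m * int q\<bar> \<le> int h" ..
  qed
  then show ?thesis by (simp add: dist_int_le_iff eq)
qed

lemma mem_nontrivial_bohr_iff:
  "u \<in> nontrivial_bohr n q a k h \<longleftrightarrow>
     u < q \<and> (\<exists>s\<in>{1..<q}. \<exists>x :: nat \<Rightarrow> int. \<forall>j\<in>{1..n}.
        \<bar>x j\<bar> \<le> int (h j) \<and> [int s * a j * int u ^ k j = x j] (mod int q))"
proof (cases "q > 0")
  case True
  have comm: "a j * int u ^ k j * int s = int s * a j * int u ^ k j" for j s
    by (simp add: mult_ac)
  have "s \<in> bohr_set n q a k h u \<longleftrightarrow> s < q \<and>
      (\<exists>x. \<forall>j\<in>{1..n}. \<bar>x j\<bar> \<le> int (h j) \<and> [int s * a j * int u ^ k j = x j] (mod int q))" for s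
    unfolding bohr_set_def mem_Collect_eq dist_int_divide_le_iff[OF True] bchoice_iff comm
      lessThan_iff ..
  moreover have "s \<in> {1..<q} \<longleftrightarrow> s < q \<and> s \<noteq> 0" for s
    by auto
  ultimately show ?thesis
    unfolding nontrivial_bohr_def mem_Collect_eq lessThan_iff by blast
next
  case False
  then show ?thesis by (simp add: nontrivial_bohr_def)
qed

end

theory Submission
  imports Defs "HOL-Computational_Algebra.Polynomial"
begin

text \<open>
  Only the first three coordinates matter. Put \<open>T = (h\<^sub>1 h\<^sub>2 h\<^sub>3)\<^sup>1\<^sup>/\<^sup>2\<close>. If \<open>u\<close> lies in the set, witnessed by
  \<open>s\<close> and \<open>x\<close>, then the pigeonhole principle yields a primitive integer vector \<open>b\<close> orthogonal to
  \<open>(x\<^sub>1, x\<^sub>2, x\<^sub>3)\<close> with \<open>\<bar>b\<^sub>j\<bar> \<le> 3 T / h\<^sub>j\<close>. Cancelling \<open>s\<close>, the element \<open>u\<close> is a root modulo \<open>q\<close> of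
  \<open>\<Sum> b\<^sub>j a\<^sub>j X\<^bsup>k\<^sub>j\<^esup>\<close>, which does not vanish modulo \<open>q\<close> and hence has \<open>O(1)\<close> roots. If \<open>h\<^sub>3 \<le> T\<close> there are
  \<open>O(T\<^sup>3 / (h\<^sub>1 h\<^sub>2 h\<^sub>3)) = O(T)\<close> such vectors \<open>b\<close>. Otherwise \<open>h\<^sub>1 h\<^sub>2 \<le> T\<close>, and the vectors
  \<open>b = (x\<^sub>2, -x\<^sub>1, 0)\<close> suffice. The logarithmic factor only enters through \<open>ln q \<ge> ln 2\<close>.
\<close>

section \<open>Roots of integer polynomials modulo a prime\<close>

text \<open>Lagrange's root bound over the field with \<open>q\<close> elements, carried out with
  integer polynomials: being nonzero modulo \<open>q\<close> means not being divisible by the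
  constant \<open>[:int q:]\<close>. The induction is on the bound \<open>d\<close>, and splitting
  off a linear factor preserves both hypotheses.\<close>

lemma card_roots_mod_prime_le:
  fixes q :: nat and p :: "int poly"
  assumes "prime q" and "degree p \<le> d" and "\<not> [:int q:] dvd p"
  shows "card {u \<in> {..<q}. int q dvd poly p (int u)} \<le> d"
  using assms(2,3)
proof (induction d arbitrary: p)
  case 0
  then obtain c where p: "p = [:c:]"
    by (auto elim: degree_eq_zeroE)
  then have "\<not> int q dvd c"
    using 0 by (simp add: const_poly_dvd_const_poly_iff)
  then show ?case
    by (simp add: p)
next
  case (Suc d)
  have prime: "prime (int q)"
    using assms(1) by simp
  show ?case
  proof (cases "\<exists>r<q. int q dvd poly p (int r)")
    case False
    then have "{u \<in> {..<q}. int q dvd poly p (int u)} = {}"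
      by auto
    then show ?thesis
      by (metis card.empty le0)
  next
    case True
    then obtain r where r: "r < q" "int q dvd poly p (int r)"
      by blast
    define s where "s = synthetic_div p (int r)"
    \<comment> \<open>The integer \<open>r\<close> need not be a root of \<open>p\<close> over the
      integers, but the remainder \<open>poly p (int r)\<close> is 0 modulo \<open>q\<close>, so
      \<open>p\<close> factors as (X - r) s modulo \<open>q\<close>.\<close>
    have p: "p = [:- int r, 1:] * s + [:poly p (int r):]"
      using synthetic_div_correct'[of "int r" p] by (simp add: s_def)
    have "degree s \<le> d"
      using Suc.prems(1) by (simp add: s_def degree_synthetic_div)
    moreover have "\<not> [:int q:] dvd s"
    proof
      assume "[:int q:] dvd s"
      moreover have "[:int q:] dvd [:poly p (int r):]"
        using r(2) by (simp add: const_poly_dvd_const_poly_iff)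
      ultimately have "[:int q:] dvd p"
        by (subst p) (intro dvd_add dvd_mult)
      then show False
        using Suc.prems(2) by blast
    qed
    ultimately have IH: "card {u \<in> {..<q}. int q dvd poly s (int u)} \<le> d"
      by (rule Suc.IH)
    have "int q dvd poly s (int u)" if "u < q" "u \<noteq> r" "int q dvd poly p (int u)" for u
    proof -
      have "poly p (int u) = (int u - int r) * poly s (int u) + poly p (int r)"
        by (subst p) (simp add: algebra_simps)
      then have "int q dvd (int u - int r) * poly s (int u)"
        using that(3) r(2) by (simp add: dvd_add_left_iff)
      moreover have "\<not> int q dvd int u - int r"
        using that r(1) zdvd_imp_le[of "int q" "int u - int r"] zdvd_imp_le[of "int q" "int r - int u"]
        by (cases "u < r") (auto simp: dvd_diff_commute)
      ultimately show ?thesis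
        using prime prime_dvd_mult_iff by blast
    qed
    then have "{u \<in> {..<q}. int q dvd poly p (int u)}
        \<subseteq> insert r {u \<in> {..<q}. int q dvd poly s (int u)}"
      by auto
    then have "card {u \<in> {..<q}. int q dvd poly p (int u)}
        \<le> card (insert r {u \<in> {..<q}. int q dvd poly s (int u)})"
      by (intro card_mono) auto
    also have "\<dots> \<le> Suc (card {u \<in> {..<q}. int q dvd poly s (int u)})"
      by (simp add: card_insert_if)
    finally show ?thesis
      using IH by linarith
  qed
qed

text \<open>Distinct exponents keep the three monomials from merging, so each \<open>c\<close> is a
  coefficient of the polynomial and one of them survives modulo \<open>q\<close>.\<close>

lemma card_trinomial_roots_mod_prime_le:
  fixes q k1 k2 k3 :: nat and c1 c2 c3 :: int
  assumes "prime q" and "k1 \<noteq> k2" "k1 \<noteq> k3" "k2 \<noteq> k3" and "k1 \<le> K" "k2 \<le> K" "k3 \<le> K"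
    and "\<not> (int q dvd c1 \<and> int q dvd c2 \<and> int q dvd c3)"
  shows "card {u \<in> {..<q}. int q dvd c1 * int u ^ k1 + c2 * int u ^ k2 + c3 * int u ^ k3} \<le> K"
proof -
  define p where "p = monom c1 k1 + monom c2 k2 + monom c3 k3"
  have "degree p \<le> K"
    unfolding p_def using assms(5-7)
    by (intro degree_add_le) (auto intro: order.trans[OF degree_monom_le])
  moreover have "\<not> [:int q:] dvd p"
  proof
    assume "[:int q:] dvd p"
    then have "int q dvd coeff p i" for i
      by (simp add: const_poly_dvd_iff)
    from this[of k1] this[of k2] this[of k3] show False
      using assms(2-4,8) by (auto simp: p_def)
  qed
  ultimately have "card {u \<in> {..<q}. int q dvd poly p (int u)} \<le> K"
    using assms(1) by (intro card_roots_mod_prime_le)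
  then show ?thesis
    by (simp add: p_def poly_monom)
qed

section \<open>Small integer vectors orthogonal to a given one\<close>

text \<open>Pigeonhole as in Siegel's lemma: a box with more than 27 T points is mapped by the
  linear form into at most 18 T + 1 <= 19 T integers, so two points collide; their difference,
  divided by its gcd, is the vector. The factor 3 is chosen so that 3^3 > 2 * 9 + 1. Primitivity
  prevents the vector from vanishing modulo \<open>q\<close> even when its entries exceed
  \<open>q\<close>.\<close>

lemma exists_small_orthogonal_vector:
  fixes x1 x2 x3 :: int and h1 h2 h3 :: nat and T :: real
  assumes "\<bar>x1\<bar> \<le> int h1" "\<bar>x2\<bar> \<le> int h2" "\<bar>x3\<bar> \<le> int h3"
    and "h1 \<ge> 1" "h2 \<ge> 1" "h3 \<ge> 1" and "T \<ge> 1" and T2: "T\<^sup>2 = real (h1 * h2 * h3)"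
  obtains b1 b2 b3 :: int where
    "\<bar>b1\<bar> \<le> \<lfloor>3 * T / h1\<rfloor>" "\<bar>b2\<bar> \<le> \<lfloor>3 * T / h2\<rfloor>" "\<bar>b3\<bar> \<le> \<lfloor>3 * T / h3\<rfloor>"
    "gcd b1 (gcd b2 b3) = 1" "b1 * x1 + b2 * x2 + b3 * x3 = 0"
proof -
  define M where "M h = \<lfloor>3 * T / real h\<rfloor>" for h :: nat
  define A where "A = {0..M h1} \<times> {0..M h2} \<times> {0..M h3}"
  define f where "f = (\<lambda>(b1, b2, b3). b1 * x1 + b2 * x2 + b3 * x3)"
  define N where "N = M h1 * int h1 + M h2 * int h2 + M h3 * int h3"
  have M0: "M h \<ge> 0" for h
    using \<open>T \<ge> 1\<close> by (simp add: M_def)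
  then have "N \<ge> 0"
    by (simp add: N_def)
  have M_le: "real_of_int (M h * int h) \<le> 3 * T" if "h \<ge> 1" for h
  proof -
    have "real_of_int (M h) \<le> 3 * T / real h"
      by (simp add: M_def)
    then show ?thesis
      using that by (simp add: field_simps)
  qed
  have M_gt: "3 * T / real h < real_of_int (M h + 1)" for h
    unfolding M_def by linarith
  have pos: "0 < 3 * T / real h" if "h \<ge> 1" for h
    using that \<open>T \<ge> 1\<close> by simp
  \<comment> \<open>The real box has volume 27 T^3 / (h1 h2 h3) = 27 T; counting 0 as well, each
    side has floor + 1 integer points, which beats its length.\<close>
  have "27 * T = 27 * T * (T\<^sup>2 / real (h1 * h2 * h3))"
    unfolding T2 using assms(4-6) by simp
  also have "\<dots> = (3 * T / h1) * (3 * T / h2) * (3 * T / h3)"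
    by (simp add: power2_eq_square)
  also have "\<dots> < real_of_int (M h1 + 1) * real_of_int (M h2 + 1) * real_of_int (M h3 + 1)"
    using assms(4-6) M_gt pos order.strict_trans[OF pos M_gt]
    by (intro mult_strict_mono mult_pos_pos) (blast intro: less_imp_le mult_pos_pos)+
  also have "\<dots> = real (card A)"
    using M0 by (simp add: A_def card_cartesian_product of_nat_nat)
  finally have cardA: "27 * T < real (card A)" .
  have "f ` A \<subseteq> {- N..N}"
  proof -
    have "\<bar>b * x\<bar> \<le> M h * int h" if "b \<in> {0..M h}" "\<bar>x\<bar> \<le> int h" for b x h
      unfolding abs_mult using that M0[of h] by (intro mult_mono) auto
    note bound = this
    show ?thesis
    proof
      fix y
      assume "y \<in> f ` A"
      then obtain b1 b2 b3 where b: "b1 \<in> {0..M h1}" "b2 \<in> {0..M h2}" "b3 \<in> {0..M h3}"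
          and y: "y = b1 * x1 + b2 * x2 + b3 * x3"
        by (auto simp: A_def f_def)
      have "\<bar>y\<bar> \<le> N"
        using bound[OF b(1) assms(1)] bound[OF b(2) assms(2)] bound[OF b(3) assms(3)]
        unfolding y N_def by linarith
      then show "y \<in> {- N..N}"
        by (simp add: abs_le_iff)
    qed
  qed
  then have "card (f ` A) \<le> card {- N..N}"
    by (intro card_mono) auto
  also have "card {- N..N} = nat (2 * N + 1)"
    by simp
  finally have "int (card (f ` A)) \<le> 2 * N + 1"
    using \<open>N \<ge> 0\<close> by linarith
  then have "real (card (f ` A)) \<le> real_of_int (2 * N + 1)"
    by linarith
  moreover have "real_of_int N \<le> 9 * T"
    using M_le[OF assms(4)] M_le[OF assms(5)] M_le[OF assms(6)] by (simp add: N_def)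
  ultimately have "card (f ` A) < card A"
    using cardA \<open>T \<ge> 1\<close> by simp
  then obtain v w where vw: "v \<in> A" "w \<in> A" "f v = f w" "v \<noteq> w"
    using pigeonhole unfolding inj_on_def by blast
  obtain v1 v2 v3 w1 w2 w3 where vw_eq: "v = (v1, v2, v3)" "w = (w1, w2, w3)"
    by (cases v, cases w) auto
  define d1 d2 d3 where d_defs: "d1 = v1 - w1" "d2 = v2 - w2" "d3 = v3 - w3"
  define g where "g = gcd d1 (gcd d2 d3)"
  have d: "\<bar>d1\<bar> \<le> M h1" "\<bar>d2\<bar> \<le> M h2" "\<bar>d3\<bar> \<le> M h3"
      "d1 * x1 + d2 * x2 + d3 * x3 = 0" "d1 \<noteq> 0 \<or> d2 \<noteq> 0 \<or> d3 \<noteq> 0"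
    using vw by (auto simp: vw_eq d_defs A_def f_def algebra_simps)
  then have "g > 0"
    by (auto simp: g_def gcd_pos_int)
  \<comment> \<open>Dividing by the positive \<open>g\<close> keeps orthogonality and does not
    enlarge the entries.\<close>
  have "g dvd d1" "g dvd d2" "g dvd d3"
    unfolding g_def by (meson dvd_trans gcd_dvd1 gcd_dvd2)+
  then obtain b1 b2 b3 where b: "d1 = g * b1" "d2 = g * b2" "d3 = g * b3"
    by (auto elim!: dvdE)
  show ?thesis
  proof (rule that[of b1 b2 b3])
    have le: "\<bar>b\<bar> \<le> \<bar>g * b\<bar>" for b
      using \<open>g > 0\<close> by (simp add: abs_mult mult_le_cancel_right1)
    show "\<bar>b1\<bar> \<le> \<lfloor>3 * T / h1\<rfloor>" "\<bar>b2\<bar> \<le> \<lfloor>3 * T / h2\<rfloor>" "\<bar>b3\<bar> \<le> \<lfloor>3 * T / h3\<rfloor>"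
      using d(1-3) le[of b1] le[of b2] le[of b3] unfolding b M_def by linarith+
    have "g * (b1 * x1 + b2 * x2 + b3 * x3) = 0"
      using d(4) by (simp add: b algebra_simps)
    then show "b1 * x1 + b2 * x2 + b3 * x3 = 0"
      using \<open>g > 0\<close> by simp
    have "g = gcd (g * b1) (gcd (g * b2) (g * b3))"
      using g_def unfolding b .
    also have "\<dots> = g * gcd b1 (gcd b2 b3)"
      using \<open>g > 0\<close> by (simp flip: gcd_mult_distrib_int)
    finally show "gcd b1 (gcd b2 b3) = 1"
      using \<open>g > 0\<close> by simp
  qed
qed

section \<open>Covering the set by root sets of trinomials\<close>

theorem theorem2p1:
  fixes n :: nat and k :: "nat \<Rightarrow> nat"
  assumes "n \<ge> 3"
    and "\<forall>i\<in>{1..n}. k i > 0"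
    and "\<forall>i\<in>{1..n}. \<forall>j\<in>{1..n}. i \<noteq> j \<longrightarrow> k i \<noteq> k j"
  shows "\<exists>c::real. c > 0 \<and>
    (\<forall>(q::nat) (a::nat \<Rightarrow> int) (h::nat \<Rightarrow> nat).
       prime q \<longrightarrow>
       (\<forall>i\<in>{1..n}. \<not> [a i = 0] (mod int q)) \<longrightarrow>
       1 \<le> h 1 \<longrightarrow>
       (\<forall>i\<in>{1..<n}. h i \<le> h (Suc i)) \<longrightarrow>
       real (card (nontrivial_bohr n q a k h))
         \<le> c * real (h 1 * h 2 * h 3) powr (1/2) * ln (real q))"
proof -
  \<comment> \<open>A crude degree bound for all the trinomials, depending on \<open>k\<close>
    alone.\<close>
  define K where "K = k 1 + k 2 + k 3"
  have k_neq: "k 1 \<noteq> k 2" "k 1 \<noteq> k 3" "k 2 \<noteq> k 3"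
    using assms(1,3) by auto
  have k_pos: "k 1 > 0" "k 2 > 0" "k 3 > 0"
    using assms(1,2) by auto
  have main: "real (card (nontrivial_bohr n q a k h))
      \<le> 343 * real K / ln 2 * real (h 1 * h 2 * h 3) powr (1/2) * ln (real q)"
    if q: "prime q" and a: "\<forall>i\<in>{1..n}. \<not> [a i = 0] (mod int q)"
      and h1: "1 \<le> h 1" and h_mono: "\<forall>i\<in>{1..<n}. h i \<le> h (Suc i)"
    for q :: nat and a :: "nat \<Rightarrow> int" and h :: "nat \<Rightarrow> nat"
  proof -
    define U where "U = nontrivial_bohr n q a k h"
    define T where "T = sqrt (real (h 1 * h 2 * h 3))"
    have prime: "prime (int q)"
      using q by simp
    have a_ndvd: "\<not> int q dvd a 1" "\<not> int q dvd a 2" "\<not> int q dvd a 3"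
      using a assms(1) by (auto simp: cong_0_iff)
    have h12: "h 1 \<le> h 2" and h23: "h 2 \<le> h 3"
      using h_mono assms(1) by (auto simp: numeral_2_eq_2 numeral_3_eq_3)
    have h_pos: "h 1 \<ge> 1" "h 2 \<ge> 1" "h 3 \<ge> 1"
      using h1 h12 h23 by auto
    have T2: "T\<^sup>2 = real (h 1 * h 2 * h 3)"
      by (simp add: T_def)
    have "h 1 * h 2 * h 3 \<ge> 1"
      using h_pos by (simp add: Suc_le_eq)
    then have T1: "T \<ge> 1"
      unfolding T_def real_sqrt_ge_1_iff by linarith
    define root where "root b u \<longleftrightarrow> (case b of (b1, b2, b3) \<Rightarrow>
        int q dvd b1 * a 1 * int u ^ k 1 + b2 * a 2 * int u ^ k 2 + b3 * a 3 * int u ^ k 3)"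
      for b and u :: nat
    define nonzero where "nonzero b \<longleftrightarrow> (case b of (b1, b2, b3) \<Rightarrow>
        \<not> (int q dvd b1 \<and> int q dvd b2 \<and> int q dvd b3))" for b
    have card_root: "card {u \<in> {..<q}. root b u} \<le> K" if "nonzero b" for b
    proof (cases b)
      case (fields b1 b2 b3)
      have "\<not> (int q dvd b1 * a 1 \<and> int q dvd b2 * a 2 \<and> int q dvd b3 * a 3)"
        using that a_ndvd prime by (auto simp: nonzero_def fields prime_dvd_mult_iff)
      then show ?thesis
        unfolding root_def fields prod.case using q k_neq
        by (intro card_trinomial_roots_mod_prime_le) (auto simp: K_def)
    qed
    \<comment> \<open>Union bound over the trinomials coded by \<open>B\<close>. Those vanishing
      modulo \<open>q\<close> have every \<open>u\<close> as a root, so they are discarded before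
      counting.\<close>
    have cover: "real (card U) \<le> real (card B) * real K"
      if "finite B" "\<And>u. u \<in> U \<Longrightarrow> \<exists>b\<in>B. nonzero b \<and> root b u" for B
    proof -
      define B' where "B' = {b \<in> B. nonzero b}"
      have "U \<subseteq> (\<Union>b\<in>B'. {u \<in> {..<q}. root b u})"
        using that(2) by (fastforce simp: B'_def U_def nontrivial_bohr_def)
      then have "card U \<le> card (\<Union>b\<in>B'. {u \<in> {..<q}. root b u})"
        using that(1) by (intro card_mono) (auto simp: B'_def)
      also have "\<dots> \<le> (\<Sum>b\<in>B'. card {u \<in> {..<q}. root b u})"
        using that(1) by (intro card_UN_le) (auto simp: B'_def)
      also have "\<dots> \<le> (\<Sum>b\<in>B'. K)"
        using card_root by (intro sum_mono) (auto simp: B'_def)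
      also have "\<dots> \<le> card B * K"
        using that(1) by (auto simp: B'_def intro!: card_mono)
      finally show ?thesis
        by (simp flip: of_nat_mult)
    qed
    have witness: "\<exists>s x. \<not> int q dvd s \<and> (\<forall>j\<in>{1,2,3}. \<bar>x j\<bar> \<le> int (h j) \<and>
        [s * a j * int u ^ k j = x j] (mod int q))" if u: "u \<in> U" for u
    proof -
      obtain s x where s: "s \<in> {1..<q}" and x: "\<forall>j\<in>{1..n}. \<bar>x j\<bar> \<le> int (h j) \<and>
          [int s * a j * int u ^ k j = x j] (mod int q)"
        using u unfolding U_def mem_nontrivial_bohr_iff by blast
      have "\<not> int q dvd int s"
        using s by (auto dest: zdvd_imp_le)
      moreover have "{1,2,3} \<subseteq> {1..n}"
        using assms(1) by auto
      ultimately show ?thesis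
        using x by blast
    qed
    \<comment> \<open>Combining the congruences with weights \<open>b\<close> gives \<open>s\<close>
      times the trinomial on the left and 0 on the right; \<open>s\<close> is a unit modulo
      \<open>q\<close>.\<close>
    have orth: "root (b1, b2, b3) u"
      if s: "\<not> int q dvd s" and x: "\<forall>j\<in>{1,2,3}. [s * a j * int u ^ k j = x j] (mod int q)"
        and 0: "b1 * x 1 + b2 * x 2 + b3 * x 3 = 0" for s u x b1 b2 b3
    proof -
      have "[b1 * (s * a 1 * int u ^ k 1) + b2 * (s * a 2 * int u ^ k 2)
          + b3 * (s * a 3 * int u ^ k 3) = b1 * x 1 + b2 * x 2 + b3 * x 3] (mod int q)"
        using x by (intro cong_add cong_scalar_left) auto
      then have "int q dvd s * (b1 * a 1 * int u ^ k 1 + b2 * a 2 * int u ^ k 2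
          + b3 * a 3 * int u ^ k 3)"
        unfolding 0 by (simp add: cong_0_iff algebra_simps)
      then show ?thesis
        using s prime by (simp add: root_def prime_dvd_mult_iff)
    qed
    have "real (card U) \<le> 343 * T * real K"
    proof (cases "real (h 3) \<le> T")
      case True
      define M where "M j = \<lfloor>3 * T / real (h j)\<rfloor>" for j :: nat
      define B where "B = {- M 1..M 1} \<times> {- M 2..M 2} \<times> {- M 3..M 3}"
      have "real (card U) \<le> real (card B) * real K"
      proof (rule cover)
        fix u
        assume "u \<in> U"
        then obtain s x where sx: "\<not> int q dvd s" "\<forall>j\<in>{1,2,3}. \<bar>x j\<bar> \<le> int (h j) \<and>
            [s * a j * int u ^ k j = x j] (mod int q)"
          using witness by blast
        obtain b1 b2 b3 where b: "\<bar>b1\<bar> \<le> M 1" "\<bar>b2\<bar> \<le> M 2" "\<bar>b3\<bar> \<le> M 3"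
            "gcd b1 (gcd b2 b3) = 1" "b1 * x 1 + b2 * x 2 + b3 * x 3 = 0"
          using exists_small_orthogonal_vector[of "x 1" "h 1" "x 2" "h 2" "x 3" "h 3" T]
            sx(2) h_pos T1 T2 unfolding M_def by auto
        have "root (b1, b2, b3) u"
          using sx b(5) by (intro orth) auto
        \<comment> \<open>A common prime factor \<open>q\<close> would divide the gcd 1.\<close>
        moreover have "nonzero (b1, b2, b3)"
          unfolding nonzero_def prod.case
          using b(4) prime not_prime_unit gcd_greatest_iff[of "int q"] by metis
        moreover have "(b1, b2, b3) \<in> B"
          using b(1-3) by (auto simp: B_def abs_le_iff)
        ultimately show "\<exists>b\<in>B. nonzero b \<and> root b u"
          by blast
      qed (simp add: B_def)
      moreover have "real (card B) \<le> 343 * T"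
      proof -
        have M_bound: "real (card {- M j..M j}) \<le> 7 * T / real (h j)"
          if "h j \<ge> 1" "h j \<le> h 3" for j
        proof -
          have "M j \<ge> 0"
            using T1 by (simp add: M_def)
          then have "real (card {- M j..M j}) = 2 * real_of_int (M j) + 1"
            by simp
          \<comment> \<open>The case assumption absorbs the summand 1: since \<open>h j\<close> <=
            \<open>h 3\<close> <= T, it is at most T / \<open>h j\<close>. Hence 7, and 343 = 7^3
            for the product.\<close>
          also have "\<dots> \<le> 2 * (3 * T / real (h j)) + T / real (h j)"
            using that True by (intro add_mono mult_left_mono) (auto simp: M_def)
          finally show ?thesis
            by simp
        qed
        have "real (card B) = real (card {- M 1..M 1}) * real (card {- M 2..M 2})
            * real (card {- M 3..M 3})"
          unfolding B_def card_cartesian_product of_nat_mult mult.assoc ..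
        also have "\<dots> \<le> (7 * T / h 1) * (7 * T / h 2) * (7 * T / h 3)"
          using h_pos h12 h23 T1 by (intro mult_mono M_bound mult_nonneg_nonneg) auto
        also have "\<dots> = 343 * T * (T\<^sup>2 / real (h 1 * h 2 * h 3))"
          by (simp add: power2_eq_square)
        also have "\<dots> = 343 * T"
          unfolding T2 using h_pos by simp
        finally show ?thesis .
      qed
      ultimately show ?thesis
        by (meson mult_right_mono of_nat_0_le_iff order.trans)
    next
      case False
      \<comment> \<open>Ranges for the vectors (x2, -x1, 0), which are orthogonal to x for any
        x3.\<close>
      define B where "B = {- int (h 2)..int (h 2)} \<times> {- int (h 1)..int (h 1)} \<times> {0 :: int}"
      have "real (card U) \<le> real (card B) * real K"
      proof (rule cover)
        fix u
        assume "u \<in> U"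
        then obtain s x where sx: "\<not> int q dvd s" "\<forall>j\<in>{1,2,3}. \<bar>x j\<bar> \<le> int (h j) \<and>
            [s * a j * int u ^ k j = x j] (mod int q)"
          using witness by blast
        have "u < q"
          using \<open>u \<in> U\<close> by (simp add: U_def nontrivial_bohr_def)
        show "\<exists>b\<in>B. nonzero b \<and> root b u"
        proof (cases "u = 0")
          \<comment> \<open>Here \<open>x 1\<close> and \<open>x 2\<close> are 0 modulo
            \<open>q\<close>, so (x2, -x1, 0) gives the zero trinomial. Any trinomial nonzero modulo
            \<open>q\<close> vanishes at 0, the exponents being positive; (1, 1, 0) lies in
            \<open>B\<close> as \<open>h 1\<close> and \<open>h 2\<close> are at least 1.\<close>
          case True
          then have "root (1, 1, 0) u"
            using k_pos by (simp add: root_def zero_power)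
          moreover have "nonzero (1, 1, 0)"
            using prime not_prime_unit by (auto simp: nonzero_def)
          moreover have "(1, 1, 0) \<in> B"
            using h_pos by (simp add: B_def)
          ultimately show ?thesis
            by blast
        next
          case False
          then have "\<not> int q dvd int u"
            using \<open>u < q\<close> by (auto dest: zdvd_imp_le)
          \<comment> \<open>Now \<open>x 1\<close> is congruent to a product of units, so the second
            entry of (x2, -x1, 0) is nonzero modulo \<open>q\<close>.\<close>
          then have "\<not> int q dvd s * a 1 * int u ^ k 1"
            using sx(1) a_ndvd(1) prime_dvd_power[OF prime]
            unfolding prime_dvd_mult_iff[OF prime] by blast
          then have "\<not> int q dvd x 1"
            using sx(2) cong_dvd_iff by blast
          then have "nonzero (x 2, - x 1, 0)"
            by (simp add: nonzero_def)
          moreover have "root (x 2, - x 1, 0) u"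
            using sx by (intro orth) auto
          moreover have "(x 2, - x 1, 0) \<in> B"
            using sx(2) by (auto simp: B_def abs_le_iff)
          ultimately show ?thesis
            by blast
        qed
      qed (simp add: B_def)
      moreover have "real (card B) \<le> 9 * T"
      proof -
        \<comment> \<open>Cancelling T from h1 h2 T <= h1 h2 h3 = T^2 bounds h1 h2 by T.\<close>
        have "T * T = real (h 1 * h 2) * real (h 3)"
          using T2 by (simp add: power2_eq_square)
        also have "\<dots> \<ge> real (h 1 * h 2) * T"
          using False by (intro mult_left_mono) auto
        finally have "real (h 1 * h 2) \<le> T"
          using T1 by (simp add: mult_le_cancel_right)
        have "card B = (2 * h 2 + 1) * (2 * h 1 + 1)"
          by (simp add: B_def card_cartesian_product nat_add_distrib nat_mult_distrib)
        also have "\<dots> \<le> (3 * h 2) * (3 * h 1)"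
          using h_pos by (intro mult_mono) auto
        finally have "real (card B) \<le> real ((3 * h 2) * (3 * h 1))"
          by (rule of_nat_mono)
        also have "\<dots> = 9 * real (h 1 * h 2)"
          by simp
        finally show ?thesis
          using \<open>real (h 1 * h 2) \<le> T\<close> by linarith
      qed
      then have "real (card B) \<le> 343 * T"
        using T1 by linarith
      ultimately show ?thesis
        by (meson mult_right_mono of_nat_0_le_iff order.trans)
    qed
    also have "\<dots> \<le> 343 * T * real K * (ln (real q) / ln 2)"
    proof -
      have "ln 2 \<le> ln (real q)"
        using prime_ge_2_nat[OF q] by simp
      then have "1 \<le> ln (real q) / ln 2"
        by simp
      then have "343 * T * real K * 1 \<le> 343 * T * real K * (ln (real q) / ln 2)"
        using T1 by (intro mult_left_mono) auto
      then show ?thesis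
        by simp
    qed
    finally show ?thesis
      unfolding U_def T_def by (simp add: powr_half_sqrt mult_ac)
  qed
  have "343 * real K / ln 2 > 0"
    using k_pos by (simp add: K_def)
  then show ?thesis
    using main by blast
qed

end
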